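(* Let $\mathbf{f}\in\mathbb{R}^n$ be an image on the domain $V=\{v_1,\ldots,v_n\}$, and let $\mathrm{MT}(\mathbf{f})=(\{C_i\}_{i\in\{1,\ldots,m\}},\mathbf{a})$ be its max-tree, so that $\mathrm{MT}_1(\mathbf{f})=\{C_i\}_{i\in\{1,\ldots,m\}}$ is its hierarchy and $\mathbf{a}_i$ is the altitude of $C_i$ in $\mathrm{MT}(\mathbf{f})$. Let $\boldsymbol{\epsilon}\in\mathbb{R}^n$ be such that $\mathrm{MT}_1(\mathbf{f})=\mathrm{MT}_1(\mathbf{f}+\boldsymbol{\epsilon})$. Then, for any node $C_i$ of $\mathrm{MT}_1(\mathbf{f})$ and any proper pixel $v_j$ of $C_i$, the altitude of $C_i$ in $\mathrm{MT}(\mathbf{f}+\boldsymbol{\epsilon})$ is equal to $\mathbf{a}_i+\boldsymbol{\epsilon}_j$.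
   Context: Let $V=\{v_1,\ldots,v_n\}$ be a finite nonempty set of cardinality $n$, whose elements are called pixels. An image is a vector $\mathbf{f}\in\mathbb{R}^n$; its $i$-th component $\mathbf{f}_i$ is the value of the pixel $v_i$. Connectivity: a notion of connectedness for subsets of $V$ is fixed, for example path connectivity in a fixed undirected graph with vertex set $V$. In general it is a family of subsets of $V$, called connected, that contains all singletons and is such that the union of two connected sets with nonempty intersection is connected. The whole set $V$ is assumed to be connected. For $X\subseteq V$, $\mathcal{CC}(X)$ denotes the set of connected components of $X$, i.e. the inclusion-maximal nonempty connected subsets of $X$ (they partition $X$; $\mathcal{CC}(\emptyset)=\emptyset$). Level sets and components of an image: for $\lambda\in\mathbb{R}$, the upper level set of $\mathbf{f}$ of level $\lambda$ is $[\mathbf{f}]_\lambda=\{v_i\in V\mid \mathbf{f}_i\geq\lambda\}$. The set of connected components of $\mathbf{f}$ is $\mathcal{CC}(\mathbf{f})=\bigcup_{\lambda\in\mathbb{R}}\mathcal{CC}([\mathbf{f}]_\lambda)$. It is a finite set of subsets of $V$, indexed as $\{C_i\}_{i\in\{1,\ldots,m\}}$ where $m$ is its cardinality. The altitude of $C_i\in\mathcal{CC}(\mathbf{f})$ is $\max\{\lambda\in\mathbb{R}\mid C_i\in\mathcal{CC}([\mathbf{f}]_\lambda)\}$. Max-tree: the max-tree of $\mathbf{f}$ is the pair $\mathrm{MT}(\mathbf{f})=(\{C_i\}_{i\in\{1,\ldots,m\}},\mathbf{a})$, where $\{C_i\}$ is $\mathcal{CC}(\mathbf{f})$ and $\mathbf{a}\in\mathbb{R}^m$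 is the vector such that $\mathbf{a}_i$ is the altitude of $C_i$. Its first element $\mathrm{MT}_1(\mathbf{f})$ is called the hierarchy of $\mathrm{MT}(\mathbf{f})$ and the elements of the hierarchy are called nodes; its second element is the altitude vector. The altitude of a node in $\mathrm{MT}(\mathbf{f}+\boldsymbol{\epsilon})$ is its altitude computed with respect to the image $\mathbf{f}+\boldsymbol{\epsilon}$. The equality $\mathrm{MT}_1(\mathbf{f})=\mathrm{MT}_1(\mathbf{f}+\boldsymbol{\epsilon})$ is equality of sets of subsets of $V$. Proper pixels: the children of a node $C_i$ are the inclusion-maximal nodes among those strictly included in $C_i$. A proper pixel of $C_i$ is a pixel $v\in C_i$ that is not contained in any child of $C_i$. *)

theory Defs
  imports "HOL-Analysis.Finite_Cartesian_Product" "HOL-Library.FuncSet"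
begin

text \<open>
  The domain \<open>V\<close> is the (finite, nonempty) type \<open>'v\<close>, so that \<open>V = UNIV\<close>; an image is a vector
  \<open>f :: real ^ 'v\<close>, and \<open>f $ v\<close> is the value of the pixel \<open>v\<close>. A notion of connectedness is given
  by the family \<open>K\<close> of the connected subsets of \<open>V\<close>; whether the empty set belongs to \<open>K\<close> is
  left open.
\<close>

definition connectivity :: "'v set set \<Rightarrow> bool" where
  "connectivity K \<longleftrightarrow>
     (\<forall>v. {v} \<in> K) \<and>
     (\<forall>X\<in>K. \<forall>Y\<in>K. X \<inter> Y \<noteq> {} \<longrightarrow> X \<union> Y \<in> K) \<and>
     UNIV \<in> K"

definition conn_components :: "'v set set \<Rightarrow> 'v set \<Rightarrow> 'v set set" where
  "conn_components K X =
     {C. C \<in> K \<and> C \<noteq> {} \<and> C \<subseteq> X \<and> (\<forall>D\<in>K. C \<subseteq> D \<and> D \<subseteq> X \<longrightarrow> D = C)}"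

definition upper_level_set :: "real ^ 'v \<Rightarrow> real \<Rightarrow> 'v set" where
  "upper_level_set f l = {v. f $ v \<ge> l}"

definition image_components :: "'v set set \<Rightarrow> real ^ 'v \<Rightarrow> 'v set set" where
  "image_components K f = (\<Union>l. conn_components K (upper_level_set f l))"

text \<open>
  The set of levels is in general infinite, so its maximum is written with \<^const>\<open>Greatest\<close>;
  \<^const>\<open>Max\<close> is meaningful on finite sets only.
\<close>

definition altitude :: "'v set set \<Rightarrow> real ^ 'v \<Rightarrow> 'v set \<Rightarrow> real" where
  "altitude K f C = (GREATEST l. C \<in> conn_components K (upper_level_set f l))"

text \<open>The altitude vector is indexed by the nodes themselves instead of by their numbers.\<close>

definition max_tree :: "'v set set \<Rightarrow> real ^ 'v \<Rightarrow> 'v set set \<times> ('v set \<Rightarrow> real)" where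
  "max_tree K f = (image_components K f, \<lambda>C\<in>image_components K f. altitude K f C)"

definition hierarchy :: "'v set set \<Rightarrow> real ^ 'v \<Rightarrow> 'v set set" where
  "hierarchy K f = fst (max_tree K f)"

definition altitude_vector :: "'v set set \<Rightarrow> real ^ 'v \<Rightarrow> 'v set \<Rightarrow> real" where
  "altitude_vector K f = snd (max_tree K f)"

definition children :: "'v set set \<Rightarrow> 'v set \<Rightarrow> 'v set set" where
  "children H C = {D \<in> H. D \<subset> C \<and> \<not> (\<exists>E\<in>H. E \<subset> C \<and> D \<subset> E)}"

definition proper_pixels :: "'v set set \<Rightarrow> 'v set \<Rightarrow> 'v set" where
  "proper_pixels H C = {v \<in> C. \<forall>D\<in>children H C. v \<notin> D}"

end

theory Submission
  imports Defs
begin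

text \<open>
  The altitude of a node is the value of the image at any of its proper pixels: the component
  of \<open>v\<close> in the level set of level \<open>f $ v\<close> is contained in every node containing \<open>v\<close>, so it
  is the node of which \<open>v\<close> is a proper pixel. As proper pixels depend on the hierarchy only,
  the altitudes of a node in \<open>f\<close> and in \<open>f + \<epsilon>\<close> differ by \<open>\<epsilon> $ v\<close>.
\<close>

text \<open>Finiteness gives a maximal connected subset of \<open>X\<close> through
  \<open>v\<close>; any connected superset of it still contains \<open>v\<close>, so it is maximal
  among all connected subsets of \<open>X\<close>.\<close>

lemma conn_component_containing:
  fixes K :: "'v::finite set set"
  assumes "connectivity K" "v \<in> X"
  obtains D where "D \<in> conn_components K X" "v \<in> D"
proof -
  let ?S = "{D \<in> K. v \<in> D \<and> D \<subseteq> X}"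
  have "{v} \<in> ?S"
    using assms by (auto simp: connectivity_def)
  then obtain D where D: "D \<in> ?S" and maximal: "\<forall>E\<in>?S. D \<subseteq> E \<longrightarrow> D = E"
    using finite_has_maximal[of ?S] by (metis (no_types, lifting) empty_iff finite)
  have "D \<in> conn_components K X"
    unfolding conn_components_def using D maximal by auto
  then show thesis using D that by simp
qed

text \<open>The overlap makes \<open>C \<union> D\<close> connected, so maximality of
  \<open>C\<close> in \<open>X\<close> absorbs \<open>D\<close>. For level sets, this nests
  components of higher levels in those of lower levels.\<close>

lemma conn_components_subset:
  assumes "connectivity K" "C \<in> conn_components K X" "D \<in> conn_components K Y"
    and "Y \<subseteq> X" "C \<inter> D \<noteq> {}"
  shows "D \<subseteq> C"
proof -
  have "C \<union> D \<in> K" "C \<union> D \<subseteq> X"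
    using assms unfolding connectivity_def conn_components_def by auto
  then have "C \<union> D = C"
    using assms(2) unfolding conn_components_def by blast
  then show ?thesis by blast
qed

lemma subset_child:
  fixes H :: "'v::finite set set"
  assumes "D \<in> H" "D \<subset> C"
  obtains E where "E \<in> children H C" "D \<subseteq> E"
proof -
  let ?S = "{E \<in> H. E \<subset> C}"
  have "D \<in> ?S" "finite ?S" using assms by simp_all
  then obtain E where E: "E \<in> ?S" "D \<subseteq> E" and maximal: "\<forall>F\<in>?S. E \<subseteq> F \<longrightarrow> E = F"
    using finite_has_maximal2[of ?S D] by metis
  have "E \<in> children H C"
    unfolding children_def using E(1) maximal by auto
  then show thesis using E(2) that by simp
qed

lemma altitude_eq_proper_pixel:
  fixes K :: "'v::finite set set"
  assumes K: "connectivity K"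
    and C: "C \<in> image_components K f"
    and v: "v \<in> proper_pixels (image_components K f) C"
  shows "altitude K f C = f $ v"
proof -
  have "v \<in> C" using v by (simp add: proper_pixels_def)
  obtain l where l: "C \<in> conn_components K (upper_level_set f l)"
    using C by (auto simp: image_components_def)
  \<comment> \<open>Serves twice: with \<open>l\<close> to compare the two level sets, and at the
    end as the upper bound required by \<open>GREATEST\<close>.\<close>
  have le: "l' \<le> f $ v" if "C \<in> conn_components K (upper_level_set f l')" for l'
    using that \<open>v \<in> C\<close> by (auto simp: conn_components_def upper_level_set_def)
  obtain D where D: "D \<in> conn_components K (upper_level_set f (f $ v))" "v \<in> D"
    using conn_component_containing[OF K, of v "upper_level_set f (f $ v)"]
    by (auto simp: upper_level_set_def)
  have "upper_level_set f (f $ v) \<subseteq> upper_level_set f l"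
    using le[OF l] by (auto simp: upper_level_set_def)
  then have "D \<subseteq> C"
    using conn_components_subset[OF K l D(1)] \<open>v \<in> C\<close> D(2) by blast
  have "D = C"
  \<comment> \<open>Otherwise \<open>D\<close> is a node strictly inside \<open>C\<close>, so some
    child of \<open>C\<close> contains \<open>v\<close>.\<close>
  proof (rule ccontr)
    assume "D \<noteq> C"
    moreover have "D \<in> image_components K f"
      using D(1) by (auto simp: image_components_def)
    ultimately obtain E where "E \<in> children (image_components K f) C" "D \<subseteq> E"
      using subset_child \<open>D \<subseteq> C\<close> by blast
    then show False using v D(2) by (auto simp: proper_pixels_def)
  qed
  then show ?thesis
    unfolding altitude_def using D(1) le by (intro Greatest_equality) auto
qed

theorem mainTheorem1:
  fixes K :: "'v::finite set set"
    and f \<epsilon> :: "real ^ 'v"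
  assumes "connectivity K"
    and "hierarchy K f = hierarchy K (f + \<epsilon>)"
  shows "\<forall>C \<in> hierarchy K f. \<forall>v \<in> proper_pixels (hierarchy K f) C.
           altitude_vector K (f + \<epsilon>) C = altitude_vector K f C + \<epsilon> $ v"
proof (intro ballI)
  fix C v
  assume C: "C \<in> hierarchy K f" and v: "v \<in> proper_pixels (hierarchy K f) C"
  \<comment> \<open>Stated for a general \<open>g\<close> so as to apply to both \<open>f\<close>
    and \<open>f + \<epsilon>\<close>, with the same proper pixel \<open>v\<close>.\<close>
  have alt: "altitude_vector K g C = g $ v" if "hierarchy K f = hierarchy K g" for g
    using altitude_eq_proper_pixel[OF assms(1), of C g v] C v that
    by (simp add: hierarchy_def altitude_vector_def max_tree_def)
  show "altitude_vector K (f + \<epsilon>) C = altitude_vector K f C + \<epsilon> $ v"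
    using alt[OF refl] alt[OF assms(2)] by simp
qed

end
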